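(* Let $m \in \mathbb{N}$ and $N = 2^m$, and let $Q_N$ be the set of the first $N$ points of the two-dimensional Sobol' sequence. If $m = 2^v$ or $m = 2^v - 1$ for some $v \in \mathbb{N}$, then \[ q_\infty(Q_N) = 2^{-m-1}. \] Otherwise (that is, if $m$ is neither of the form $2^v$ nor of the form $2^v-1$ with $v \in \mathbb{N}$), decomposing $m$ as $m = 2^v + 2^w + c$ with integers $v > w \ge 0$ and $0 \le c < 2^w$, we have \[ q_\infty(Q_N) = 2^{-2^v - 2^w}. \]
   Context: $\mathbb{N}$ is the set of positive integers, $\mathbb{N}_0 = \mathbb{N} \cup \{0\}$, and $\mathbb{F}_2$ is the field with two elements. For a finite set $Q \subset [0,1]^2$ with at least two points, the $\ell^\infty$-separation radius is $q_\infty(Q) := \frac12 \min_{x,y \in Q,\, x \ne y} \|x-y\|_\infty$. For $m \in \mathbb{N}$ and an integer $0 \le n < 2^m$ with binary expansion $n = n_1 + 2n_2 + \cdots + 2^{m-1} n_m$, $n_i \in \{0,1\}$, put $\vec{n} = (n_1,\dots,n_m)^\top \in \mathbb{F}_2^m$. For $\vec{z} = (z_1,\dots,z_m)^\top \in \mathbb{F}_2^m$, identify each $z_i$ with an element of $\{0,1\}$ and put $\phi(\vec{z}) = \sum_{i=1}^m z_i 2^{-i} \in [0,1)$. The Pascal matrix $P_m \in \mathbb{F}_2^{m\times m}$ has $(i,j)$ entry $\binom{j-1}{i-1} \bmod 2$ for $1 \le i,j \le m$. The two-dimensional Sobol' sequence $(\boldsymbol{x}_n)_{n \in \mathbb{N}_0}$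 in $[0,1)^2$ is defined by $\boldsymbol{x}_n := (\phi(\vec{n}), \phi(P_m \vec{n}))$, where $m \in \mathbb{N}$ is any integer with $n < 2^m$ (the value does not depend on the choice of $m$), the product $P_m\vec n$ being taken over $\mathbb{F}_2$. The set of the first $N$ points is $Q_N = \{\boldsymbol{x}_0, \dots, \boldsymbol{x}_{N-1}\}$. *)

theory Defs
  imports
    "HOL-Analysis.Linear_Algebra"
    "HOL-Library.Z2"
    "Jordan_Normal_Form.Matrix"
begin

text \<open>
  The field with two elements is the type \<^typ>\<open>bit\<close> of \<open>HOL-Library.Z2\<close>. Vectors and matrices are
  those of \<open>Jordan_Normal_Form.Matrix\<close>, whose indices start at 0: the entry written with index
  \<open>i\<close> on paper has index \<open>i - 1\<close> here.
\<close>

definition digit_vec :: "nat \<Rightarrow> nat \<Rightarrow> bit vec" where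
  "digit_vec m n = vec m (\<lambda>i. of_nat (n div 2 ^ i mod 2))"

definition phi :: "bit vec \<Rightarrow> real" where
  "phi z = (\<Sum>i<dim_vec z. of_bit (z $ i) / 2 ^ (i + 1))"

definition pascal_mat :: "nat \<Rightarrow> bit mat" where
  "pascal_mat m = mat m m (\<lambda>(i, j). of_nat (j choose i))"

definition sobol_trunc :: "nat \<Rightarrow> nat \<Rightarrow> real \<times> real" where
  "sobol_trunc m n = (phi (digit_vec m n), phi (pascal_mat m *\<^sub>v digit_vec m n))"

text \<open>Any \<open>m \<ge> 1\<close> with \<open>n < 2 ^ m\<close> may replace the least one: see \<open>sobol_eq_trunc\<close> below.\<close>

definition sobol :: "nat \<Rightarrow> real \<times> real" where
  "sobol n = sobol_trunc (LEAST m. 1 \<le> m \<and> n < 2 ^ m) n"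

definition sobol_set :: "nat \<Rightarrow> (real \<times> real) set" where
  "sobol_set N = sobol ` {0..<N}"

text \<open>
  \<^const>\<open>infnorm\<close> is the maximum norm on the plane, see \<open>infnorm_plane\<close>. The value is
  meaningful only for finite sets with at least two points.
\<close>

definition sep_radius :: "(real \<times> real) set \<Rightarrow> real" where
  "sep_radius Q = 1 / 2 * Min {infnorm (x - y) | x y. x \<in> Q \<and> y \<in> Q \<and> x \<noteq> y}"

lemma infnorm_plane: "infnorm (x :: real \<times> real) = max \<bar>fst x\<bar> \<bar>snd x\<bar>"
proof -
  have "(\<lambda>b. \<bar>x \<bullet> b\<bar>) ` (Basis :: (real \<times> real) set) = {\<bar>fst x\<bar>, \<bar>snd x\<bar>}"
    by (cases x) (auto simp: Basis_prod_def)
  then show ?thesis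
    by (simp add: infnorm_Max)
qed

lemma phi_extend:
  assumes "m \<le> m'" "dim_vec z = m" "dim_vec z' = m'"
    and "\<And>i. i < m \<Longrightarrow> z' $ i = z $ i" "\<And>i. m \<le> i \<Longrightarrow> i < m' \<Longrightarrow> z' $ i = 0"
  shows "phi z' = phi z"
  unfolding phi_def assms(2,3)
  by (rule sum.mono_neutral_cong_right) (use assms in auto)

lemma sobol_trunc_extend:
  assumes "m \<le> m'" "n < 2 ^ m"
  shows "sobol_trunc m' n = sobol_trunc m n"
proof -
  have zero: "n div 2 ^ i = 0" if "m \<le> i" for i
    using assms(2) that by (meson div_less less_le_trans one_le_numeral power_increasing)
  have mult: "(pascal_mat k *\<^sub>v digit_vec k n) $ i
      = (\<Sum>j<k. of_nat (j choose i) * of_nat (n div 2 ^ j mod 2))" if "i < k" for i k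
    using that by (simp add: pascal_mat_def digit_vec_def scalar_prod_def lessThan_atLeast0)
  have cut: "(\<Sum>j<m'. of_nat (j choose i) * of_nat (n div 2 ^ j mod 2) :: bit)
      = (\<Sum>j<m. of_nat (j choose i) * of_nat (n div 2 ^ j mod 2))" for i
    by (rule sum.mono_neutral_right) (use assms zero in auto)
  have "phi (digit_vec m' n) = phi (digit_vec m n)"
    by (rule phi_extend[OF assms(1)]) (use assms zero in \<open>auto simp: digit_vec_def\<close>)
  moreover have "phi (pascal_mat m' *\<^sub>v digit_vec m' n) = phi (pascal_mat m *\<^sub>v digit_vec m n)"
  proof (rule phi_extend[OF assms(1)])
    fix i assume "i < m"
    then show "(pascal_mat m' *\<^sub>v digit_vec m' n) $ i = (pascal_mat m *\<^sub>v digit_vec m n) $ i"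
      using assms(1) by (simp only: mult cut order.strict_trans2)
  next
    fix i assume i: "m \<le> i" "i < m'"
    have "(\<Sum>j<m. of_nat (j choose i) * of_nat (n div 2 ^ j mod 2) :: bit) = 0"
      by (rule sum.neutral) (use i in \<open>auto simp: binomial_eq_0\<close>)
    then show "(pascal_mat m' *\<^sub>v digit_vec m' n) $ i = 0"
      using i by (simp only: mult cut)
  qed (simp_all add: pascal_mat_def)
  ultimately show ?thesis
    by (simp add: sobol_trunc_def)
qed

lemma sobol_eq_trunc:
  assumes "1 \<le> m" "n < 2 ^ m"
  shows "sobol n = sobol_trunc m n"
proof -
  let ?P = "\<lambda>m. 1 \<le> m \<and> n < 2 ^ m"
  have "?P (Least ?P)" "Least ?P \<le> m"
    using LeastI[of ?P m] Least_le[of ?P m] assms by auto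
  then show ?thesis
    unfolding sobol_def using sobol_trunc_extend by metis
qed

end

theory Submission
  imports Defs "HOL-Computational_Algebra.Polynomial"
begin

text \<open>
  Encode the digit vector of \<open>n < 2 ^ m\<close> as a polynomial \<open>p\<close> over the field with two elements. The
  Pascal matrix then becomes the substitution \<open>p(x) \<mapsto> p(x + 1)\<close>, an involution, and the point \<open>x\<^sub>n\<close> is
  read off the coefficients of \<open>p(x)\<close> and \<open>p(x + 1)\<close>. Two binary strings whose values differ by at
  most one differ by a block \<open>0 \<dots> 0 1 \<dots> 1\<close>. So if \<open>m = V + W + c\<close> with \<open>V = 2 ^ v\<close>, \<open>W = 2 ^ w\<close>, and two
  points are closer than \<open>2 ^ (c + 1)\<close> grid units, the difference \<open>f\<close> of their polynomials yields
  \<open>F = x (x + 1) f\<close> of degree at most \<open>V + W + c + 1\<close> satisfying \<open>F \<equiv> x ^ A\<close> modulo \<open>x ^ (V + W)\<close> and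
  \<open>F \<equiv> (x + 1) ^ B\<close> modulo \<open>(x + 1) ^ (V + W)\<close>. Since \<open>(x + 1) ^ V = x ^ V + 1\<close>, these congruences
  force \<open>F = x ^ W (x + 1) ^ V\<close> or, if \<open>c + 1 = W\<close>, \<open>F = x ^ (2 W) (x + 1) ^ V\<close>, up to the
  substitution. In the first case the last \<open>c + 1\<close> digits agree, so the distance is a multiple of
  \<open>2 ^ (c + 1)\<close>. In the second case the carries needed in the two coordinates are incompatible.
  Conversely, \<open>f = x ^ (W - 1) (x + 1) ^ (V - 1)\<close> is attained by two points with the right carries.
\<close>

subsection \<open>Polynomials over the field with two elements\<close>

declare add_bit_eq_xor [simp del] mult_bit_eq_and [simp del] power_bit_unfold [simp del]

definition xp1 :: "bit poly" where "xp1 = [:1, 1:]"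
abbreviation xpow :: "nat \<Rightarrow> bit poly" where "xpow k \<equiv> monom 1 k"
abbreviation taylor_shift :: "bit poly \<Rightarrow> bit poly" where "taylor_shift p \<equiv> pcompose p xp1"

lemma bit_add_self [simp]: "b + b = (0::bit)"
  by (cases b) (simp_all add: add_bit_eq_xor)

lemma bit_add_eq_0_iff: "a + b = 0 \<longleftrightarrow> a = (b::bit)"
  by (cases a; cases b) (simp_all add: add_bit_eq_xor)

lemma bit_poly_add_self [simp]: "p + p = (0::bit poly)"
  by (simp only: poly_eq_iff coeff_add bit_add_self coeff_0 simp_thms)

lemma bit_poly_add_self_left [simp]: "p + (p + q) = (q::bit poly)"
  by (simp flip: add.assoc)

lemma bit_poly_add_eq_0_iff: "p + q = 0 \<longleftrightarrow> p = (q::bit poly)"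
  by (simp add: poly_eq_iff bit_add_eq_0_iff)

lemma xp1_altdef: "xp1 = xpow 1 + 1"
  by (simp add: xp1_def monom_altdef one_pCons)

lemma pcompose_power: "pcompose (p ^ n) q = pcompose p q ^ n" for p q :: "'a::comm_semiring_1 poly"
  by (induction n) (simp_all add: pcompose_mult pcompose_1)

lemma xpow_altdef: "xpow k = xpow 1 ^ k"
  by (simp add: monom_power)

lemma taylor_shift_xp1: "taylor_shift xp1 = xpow 1"
  by (simp add: xp1_def pcompose_pCons monom_altdef one_pCons)

lemma taylor_shift_xpow [simp]: "taylor_shift (xpow k) = xp1 ^ k"
proof -
  have "taylor_shift (xpow 1) = xp1"
    by (simp add: xp1_def pcompose_pCons monom_altdef)
  then show ?thesis
    by (subst xpow_altdef) (simp only: pcompose_power)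
qed

lemma taylor_shift_xp1_power [simp]: "taylor_shift (xp1 ^ k) = xpow k"
  by (simp only: pcompose_power taylor_shift_xp1 xpow_altdef[symmetric])

text \<open>Since \<open>1 + 1 = 0\<close>, the substitution undoes itself; the two coordinates thus
  play symmetric roles.\<close>

lemma taylor_shift_taylor_shift [simp]: "taylor_shift (taylor_shift p) = p"
proof -
  have "pcompose xp1 xp1 = [:0, 1:]"
    using taylor_shift_xp1 by (simp add: monom_altdef)
  then show ?thesis
    by (simp only: pcompose_assoc[symmetric] pcompose_idR)
qed

lemma degree_taylor_shift [simp]: "degree (taylor_shift p) = degree p"
  by (simp add: xp1_def degree_pcompose)

lemma taylor_shift_eq_0_iff [simp]: "taylor_shift p = 0 \<longleftrightarrow> p = 0"
  by (rule pcompose_eq_0_iff) (simp add: xp1_def)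

lemma taylor_shift_dvd: "p dvd q \<Longrightarrow> taylor_shift p dvd taylor_shift q"
  by (auto simp: dvd_def pcompose_mult)

lemma degree_xp1_power [simp]: "degree (xp1 ^ k) = k"
  unfolding xp1_def by (rule degree_linear_power)

lemma degree_xpow [simp]: "degree (xpow k) = k"
  by (simp add: degree_monom_eq)

lemma xp1_power_ne_0 [simp]: "xp1 ^ k \<noteq> 0" "xp1 \<noteq> 0"
  by (simp_all add: xp1_def)

text \<open>Squaring is additive in characteristic 2.\<close>

lemma xp1_power_2_power: "xp1 ^ (2 ^ k) = xpow (2 ^ k) + 1"
proof (induction k)
  case 0
  show ?case by (simp only: power_0 power_one_right xp1_altdef)
next
  case (Suc k)
  have "xp1 ^ (2 ^ Suc k) = (xp1 ^ (2 ^ k)) * (xp1 ^ (2 ^ k))"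
    by (simp flip: power_add add: mult_2)
  also have "\<dots> = xpow (2 ^ Suc k) + (xpow (2 ^ k) + xpow (2 ^ k)) + 1"
    unfolding Suc.IH by (simp add: algebra_simps mult_monom mult_2)
  finally show ?case by simp
qed

lemma sum_xpow_mult_xp1: "(\<Sum>i<l. xpow i) * xp1 = xpow l + 1"
proof (induction l)
  case (Suc l)
  have "(\<Sum>i<Suc l. xpow i) * xp1 = (xpow l + 1) + xpow l * xp1"
    using Suc by (simp add: distrib_right)
  also have "xpow l * xp1 = xpow (Suc l) + xpow l"
    unfolding xp1_altdef by (simp add: distrib_left mult_monom)
  also have "xpow l + 1 + (xpow (Suc l) + xpow l) = xpow (Suc l) + 1 + (xpow l + xpow l)"
    by (simp only: ac_simps)
  finally show ?case by simp
qed (simp add: one_pCons monom_altdef)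

text \<open>All binomial coefficients of \<open>2 ^ k - 1\<close> are odd; this follows by
  cancelling \<open>xp1\<close> between the geometric sum and the previous identity for
  \<open>xp1 ^ (2 ^ k)\<close>.\<close>

lemma xp1_power_pred: "xp1 ^ (2 ^ k - 1) = (\<Sum>i<2 ^ k. xpow i)"
proof -
  have "xp1 ^ (2 ^ k - 1) * xp1 = xp1 ^ (2 ^ k)"
    by (simp only: mult.commute[of _ xp1]) (simp flip: power_Suc)
  also have "\<dots> = (\<Sum>i<2 ^ k. xpow i) * xp1"
    by (simp only: sum_xpow_mult_xp1 xp1_power_2_power)
  finally show ?thesis
    by simp
qed

lemma coeff_xpow_mult_xp1_power_pred:
  "coeff (xpow a * xp1 ^ (2 ^ k - 1)) i = of_bool (a \<le> i \<and> i < a + 2 ^ k)"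
  unfolding xp1_power_pred by (auto simp: coeff_monom_mult coeff_sum)

text \<open>\<open>p + q\<close> is also the difference: congruent residues of degree below that of
  the modulus coincide.\<close>

lemma dvd_degree_less_imp_eq:
  fixes p q d :: "bit poly"
  assumes "d dvd p + q" "degree p < degree d" "degree q < degree d"
  shows "p = q"
proof -
  have "degree (p + q) < degree d"
    by (rule degree_add_less) (use assms in auto)
  then show ?thesis
    using assms(1) dvd_imp_degree_le[of d "p + q"] by (auto simp: bit_poly_add_eq_0_iff)
qed

text \<open>Multiplying by \<open>x (1 + x)\<close> collapses a block of ones to its starting index.\<close>

lemma xpow_dvd_if_block:
  assumes "\<And>i. i < t \<Longrightarrow> coeff f i = of_bool (a \<le> i)" "a \<le> t"
  shows "xpow (Suc t) dvd xpow 1 * xp1 * f + xpow (Suc a)"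
proof -
  \<comment> \<open>\<open>xp1 * f\<close> adds neighbouring coefficients of \<open>f\<close>, so
    below \<open>t\<close> only the start of the block survives.\<close>
  have "xpow t dvd xp1 * f + xpow a"
    unfolding monom_1_dvd_iff'
  proof (intro allI impI)
    fix i assume "i < t"
    then show "coeff (xp1 * f + xpow a) i = 0"
      using assms(1)[of i] assms(1)[of "i - 1"]
      by (cases i) (auto simp: xp1_def coeff_pCons)
  qed
  then have "xpow 1 * xpow t dvd xpow 1 * (xp1 * f + xpow a)"
    by (rule mult_dvd_mono[OF dvd_refl])
  then show ?thesis
    by (simp add: mult_monom distrib_left mult.assoc)
qed

subsection \<open>Binary values and Sobol' points\<close>

text \<open>Index 0 holds the most significant digit, as in \<open>phi\<close>; integer values allow
  signed differences.\<close>

primrec bin_val :: "nat \<Rightarrow> (nat \<Rightarrow> bit) \<Rightarrow> int" where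
  "bin_val 0 z = 0"
| "bin_val (Suc m) z = 2 * bin_val m z + of_bit (z m)"

lemma bin_val_cong: "(\<And>i. i < m \<Longrightarrow> z i = z' i) \<Longrightarrow> bin_val m z = bin_val m z'"
  by (induction m) auto

lemma bin_val_eq_iff: "bin_val m z = bin_val m z' \<longleftrightarrow> (\<forall>i<m. z i = z' i)"
proof (induction m)
  case (Suc m)
  have "bin_val (Suc m) z = bin_val (Suc m) z' \<longleftrightarrow> bin_val m z = bin_val m z' \<and> z m = z' m"
    by (cases "z m"; cases "z' m"; simp; presburger)
  then show ?case
    using Suc by (auto simp: less_Suc_eq)
qed simp

lemma bin_val_add_split: "\<exists>r. 0 \<le> r \<and> r < 2 ^ k \<and> bin_val (t + k) z = 2 ^ k * bin_val t z + r"
proof (induction k)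
  case (Suc k)
  then obtain r where r: "0 \<le> r" "r < 2 ^ k" "bin_val (t + k) z = 2 ^ k * bin_val t z + r"
    by blast
  show ?case
    by (rule exI[of _ "2 * r + of_bit (z (t + k))"]) (use r in auto)
qed simp

text \<open>The discarded remainders differ by less than \<open>2 ^ k\<close>, so the prefixes
  differ by less than \<open>c + 1\<close>.\<close>

lemma bin_val_diff_prefix_le:
  assumes "\<bar>bin_val (t + k) z - bin_val (t + k) z'\<bar> < 2 ^ k * c"
  shows "\<bar>bin_val t z - bin_val t z'\<bar> \<le> c"
proof (rule ccontr)
  obtain r where r: "0 \<le> r" "r < 2 ^ k" "bin_val (t + k) z = 2 ^ k * bin_val t z + r"
    using bin_val_add_split by blast
  obtain r' where r': "0 \<le> r'" "r' < 2 ^ k" "bin_val (t + k) z' = 2 ^ k * bin_val t z' + r'"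
    using bin_val_add_split by blast
  define d where "d = bin_val t z - bin_val t z'"
  have "bin_val (t + k) z - bin_val (t + k) z' = 2 ^ k * d + (r - r')"
    using r r' by (simp add: d_def algebra_simps)
  with assms have less: "2 ^ k * d + (r - r') < 2 ^ k * c" "- (2 ^ k * c) < 2 ^ k * d + (r - r')"
    by linarith+
  assume "\<not> \<bar>bin_val t z - bin_val t z'\<bar> \<le> c"
  then consider "c + 1 \<le> d" | "d \<le> - (c + 1)"
    unfolding d_def by linarith
  then show False
  proof cases
    case 1
    then have "2 ^ k * (c + 1) \<le> 2 ^ k * d"
      by (intro mult_left_mono) auto
    then show False
      using less r r' by (simp add: distrib_left)
  next
    case 2
    then have "2 ^ k * d \<le> 2 ^ k * - (c + 1)"
      by (intro mult_left_mono) auto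
    then have "2 ^ k * d \<le> - (2 ^ k * c) - 2 ^ k"
      by (simp add: right_diff_distrib)
    then show False
      using less r r' by linarith
  qed
qed

lemma bin_val_diff_eq_suffix:
  assumes "\<And>i. t \<le> i \<Longrightarrow> z i = z' i"
  shows "bin_val (t + k) z - bin_val (t + k) z' = 2 ^ k * (bin_val t z - bin_val t z')"
proof (induction k)
  case (Suc k)
  then show ?case
    using assms[of "t + k"] by (simp add: algebra_simps)
qed simp

lemma ex_less_Suc: "(\<exists>a<Suc t. P a) \<longleftrightarrow> P t \<or> (\<exists>a<t. P a)"
  by (auto simp: less_Suc_eq)

text \<open>Adding one turns a tail \<open>0 1 ... 1\<close> into \<open>1 0 ... 0\<close>;
  \<open>a\<close> is where the carry stops.\<close>

lemma bin_val_succ_iff: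
  "bin_val t z' = bin_val t z + 1 \<longleftrightarrow>
    (\<exists>a<t. (\<forall>i<a. z i = z' i) \<and> (\<forall>i<t. a \<le> i \<longrightarrow> z i = of_bool (a < i) \<and> z' i = of_bool (i = a)))"
proof (induction t)
  case (Suc t)
  let ?Q = "\<lambda>t a. (\<forall>i<a. z i = z' i) \<and> (\<forall>i<t. a \<le> i \<longrightarrow> z i = of_bool (a < i) \<and> z' i = of_bool (i = a))"
  have step: "?Q (Suc t) a \<longleftrightarrow> z t = 1 \<and> z' t = 0 \<and> ?Q t a" if "a < t" for a
    using that by (simp add: All_less_Suc conj_left_commute conj_commute)
  have "bin_val (Suc t) z' = bin_val (Suc t) z + 1 \<longleftrightarrow>
      (z t = 0 \<and> z' t = 1 \<and> bin_val t z = bin_val t z') \<or> (z t = 1 \<and> z' t = 0 \<and> bin_val t z' = bin_val t z + 1)"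
    by (cases "z t"; cases "z' t"; simp; presburger)
  also have "\<dots> \<longleftrightarrow> ?Q (Suc t) t \<or> (z t = 1 \<and> z' t = 0 \<and> (\<exists>a<t. ?Q t a))"
    unfolding Suc.IH bin_val_eq_iff by (auto simp: less_Suc_eq le_less)
  also have "\<dots> \<longleftrightarrow> ?Q (Suc t) t \<or> (\<exists>a<t. ?Q (Suc t) a)"
    using step by blast
  also have "\<dots> \<longleftrightarrow> (\<exists>a<Suc t. ?Q (Suc t) a)"
    by (rule ex_less_Suc[of t "?Q (Suc t)", symmetric])
  finally show ?case .
qed simp

text \<open>The digits differ exactly from the carry position on; \<open>a = t\<close> stands for
  equal values.\<close>

lemma bin_val_adjacent_imp_block:
  assumes "\<bar>bin_val t z - bin_val t z'\<bar> \<le> 1"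
  shows "\<exists>a\<le>t. \<forall>i<t. z i + z' i = of_bool (a \<le> i)"
proof -
  have block: "\<exists>a\<le>t. \<forall>i<t. z i + z' i = of_bool (a \<le> i)"
    if "bin_val t z' = bin_val t z + 1" for z z' :: "nat \<Rightarrow> bit"
  proof -
    obtain a where a: "a < t" "\<And>i. i < a \<Longrightarrow> z i = z' i"
        "\<And>i. i < t \<Longrightarrow> a \<le> i \<Longrightarrow> z i = of_bool (a < i) \<and> z' i = of_bool (i = a)"
      using \<open>bin_val t z' = bin_val t z + 1\<close> unfolding bin_val_succ_iff by blast
    have "z i + z' i = of_bool (a \<le> i)" if "i < t" for i
      using a(2)[of i] a(3)[of i] that by (cases "i < a"; cases "i = a") auto
    then show ?thesis
      using a(1) by (intro exI[of _ a]) auto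
  qed
  consider "bin_val t z = bin_val t z'" | "bin_val t z' = bin_val t z + 1" | "bin_val t z = bin_val t z' + 1"
    using assms by linarith
  then show ?thesis
  proof cases
    case 1
    then show ?thesis
      by (intro exI[of _ t]) (simp add: bin_val_eq_iff)
  next
    case 2
    then show ?thesis
      by (rule block)
  next
    case 3
    then show ?thesis
      using block[of z z'] by (simp add: add.commute)
  qed
qed

lemma sum_bits_eq_bin_val: "(\<Sum>i<m. of_bit (z i) / 2 ^ (i + 1)) = (of_int (bin_val m z) / 2 ^ m :: real)"
  by (induction m) (auto simp: field_simps)

lemma phi_eq_bin_val: "phi z = of_int (bin_val (dim_vec z) (($) z)) / 2 ^ dim_vec z"
  unfolding phi_def by (rule sum_bits_eq_bin_val)

section \<open>Sobol' points as polynomials\<close>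

definition digit_poly :: "nat \<Rightarrow> nat \<Rightarrow> bit poly" where
  "digit_poly m n = (\<Sum>j<m. monom (of_nat (n div 2 ^ j mod 2)) j)"

lemma coeff_digit_poly: "coeff (digit_poly m n) i = (if i < m then of_nat (n div 2 ^ i mod 2) else 0)"
  by (simp add: digit_poly_def coeff_sum)

lemma coeff_xp1_power: "coeff (xp1 ^ n) i = of_nat (n choose i)"
proof (cases "i \<le> n")
  case True
  then show ?thesis
    unfolding xp1_def by (subst coeff_linear_poly_power) auto
next
  case False
  then show ?thesis
    by (simp add: coeff_eq_0 binomial_eq_0)
qed

lemma pcompose_monom: "pcompose (monom c k) q = smult c (q ^ k)" for c :: "'a::comm_semiring_1"
  by (induction k) (simp_all add: monom_0 monom_Suc pcompose_pCons mult.commute)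

text \<open>The coefficients of \<open>xp1 ^ j\<close> are the binomials in column \<open>j\<close>
  of the Pascal matrix.\<close>

lemma coeff_taylor_shift_digit_poly:
  assumes "i < m"
  shows "coeff (taylor_shift (digit_poly m n)) i = (pascal_mat m *\<^sub>v digit_vec m n) $ i"
  using assms
  by (simp add: digit_poly_def pascal_mat_def digit_vec_def scalar_prod_def lessThan_atLeast0
      pcompose_sum pcompose_monom coeff_sum coeff_xp1_power mult.commute)

definition grid_pt :: "nat \<Rightarrow> bit poly \<Rightarrow> real \<times> real" where
  "grid_pt m p = (of_int (bin_val m (coeff p)) / 2 ^ m, of_int (bin_val m (coeff (taylor_shift p))) / 2 ^ m)"

lemma sobol_eq_grid_pt:
  assumes "1 \<le> m" "n < 2 ^ m"
  shows "sobol n = grid_pt m (digit_poly m n)"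
proof -
  have dim: "dim_vec (digit_vec m n) = m" "dim_vec (pascal_mat m *\<^sub>v digit_vec m n) = m"
    by (simp_all add: digit_vec_def pascal_mat_def)
  have "bin_val m (($) (digit_vec m n)) = bin_val m (coeff (digit_poly m n))"
    by (rule bin_val_cong) (simp add: coeff_digit_poly digit_vec_def)
  moreover have "bin_val m (($) (pascal_mat m *\<^sub>v digit_vec m n)) = bin_val m (coeff (taylor_shift (digit_poly m n)))"
    by (rule bin_val_cong) (simp only: coeff_taylor_shift_digit_poly)
  ultimately show ?thesis
    by (simp only: sobol_eq_trunc[OF assms] sobol_trunc_def phi_eq_bin_val dim grid_pt_def)
qed

lemma ex_nat_with_digits:
  "\<exists>n<2 ^ m. \<forall>i<m. of_nat (n div 2 ^ i mod 2) = (z i :: bit)"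
proof (induction m)
  case (Suc m)
  then obtain n where n: "n < 2 ^ m" "\<forall>i<m. of_nat (n div 2 ^ i mod 2) = z i"
    by blast
  let ?n = "n + 2 ^ m * of_bit (z m)"
  have "?n < 2 ^ Suc m"
    using n(1) by (auto simp: of_bool_def)
  moreover have "of_nat (?n div 2 ^ i mod 2) = z i" if "i < Suc m" for i
  proof (cases "i = m")
    case True
    then show ?thesis
      using n(1) by (cases "z m") auto
  next
    case False
    then obtain k where k: "m = i + Suc k"
      using \<open>i < Suc m\<close> less_imp_Suc_add[of i m] by auto
    have "?n = n + 2 ^ i * (2 * 2 ^ k * of_bit (z m))"
      unfolding k by (simp add: power_add)
    then have "?n div 2 ^ i = n div 2 ^ i + 2 * 2 ^ k * of_bit (z m)"
      by (simp only: div_mult_self2) simp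
    then have "?n div 2 ^ i mod 2 = n div 2 ^ i mod 2"
      by (simp add: mult.assoc)
    then show ?thesis
      using n(2) k by auto
  qed
  ultimately show ?case
    by blast
qed simp

text \<open>The digits of the numbers below \<open>2 ^ m\<close> exhaust all bit patterns of length
  \<open>m\<close>, hence all polynomials of degree below \<open>m\<close>.\<close>

lemma sobol_set_eq_grid_pt:
  assumes "1 \<le> m"
  shows "sobol_set (2 ^ m) = grid_pt m ` {p. degree p < m}"
proof
  have "degree (digit_poly m n) < m" for n
    using assms by (intro degree_lessI) (auto simp: coeff_digit_poly)
  then show "sobol_set (2 ^ m) \<subseteq> grid_pt m ` {p. degree p < m}"
    using sobol_eq_grid_pt[OF assms] by (auto simp: sobol_set_def)
next
  show "grid_pt m ` {p. degree p < m} \<subseteq> sobol_set (2 ^ m)"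
  proof (rule image_subsetI)
    fix p :: "bit poly" assume "p \<in> {p. degree p < m}"
    then have p: "degree p < m" by simp
    obtain n where n: "n < 2 ^ m" "\<forall>i<m. of_nat (n div 2 ^ i mod 2) = coeff p i"
      using ex_nat_with_digits by blast
    have "digit_poly m n = p"
      using n(2) p by (auto simp: poly_eq_iff coeff_digit_poly coeff_eq_0)
    then show "grid_pt m p \<in> sobol_set (2 ^ m)"
      using imageI[of n "{0..<2 ^ m}" sobol] sobol_eq_grid_pt[OF assms n(1)] n(1)
      by (simp add: sobol_set_def)
  qed
qed

section \<open>Grid distances and the separation radius\<close>

definition grid_dist :: "nat \<Rightarrow> bit poly \<Rightarrow> bit poly \<Rightarrow> int" where
  "grid_dist m p p' = max \<bar>bin_val m (coeff p) - bin_val m (coeff p')\<bar>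
     \<bar>bin_val m (coeff (taylor_shift p)) - bin_val m (coeff (taylor_shift p'))\<bar>"

lemma infnorm_grid_pt_diff: "infnorm (grid_pt m p - grid_pt m p') = of_int (grid_dist m p p') / 2 ^ m"
proof -
  have "\<bar>real_of_int a / 2 ^ m - of_int b / 2 ^ m\<bar> = of_int \<bar>a - b\<bar> / 2 ^ m" for a b
    by (simp flip: diff_divide_distrib)
  moreover have "max (x / 2 ^ m) (y / 2 ^ m) = max x y / (2 ^ m :: real)" for x y
    by (simp add: max_def divide_le_cancel)
  ultimately show ?thesis
    by (simp add: infnorm_plane grid_pt_def grid_dist_def)
qed

text \<open>Reduces the theorem to integers: an attained lower bound \<open>K\<close> of the grid
  distances is their minimum, and the factor 1/2 raises the exponent to
  \<open>m + 1\<close>.\<close>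

lemma sep_radius_sobol_set:
  assumes "1 \<le> m" "0 < K"
    and "degree p < m" "degree p' < m" "grid_dist m p p' = K"
    and lower: "\<And>p p'. degree p < m \<Longrightarrow> degree p' < m \<Longrightarrow> p \<noteq> p' \<Longrightarrow> K \<le> grid_dist m p p'"
  shows "sep_radius (sobol_set (2 ^ m)) = of_int K / 2 ^ (m + 1)"
proof -
  let ?Q = "sobol_set (2 ^ m)"
  let ?S = "{infnorm (x - y) |x y. x \<in> ?Q \<and> y \<in> ?Q \<and> x \<noteq> y}"
  have "finite ?Q"
    by (simp add: sobol_set_def)
  then have "finite ((\<lambda>(x, y). infnorm (x - y)) ` (?Q \<times> ?Q))"
    by blast
  then have "finite ?S"
  proof (rule rev_finite_subset, intro subsetI)
    fix s assume "s \<in> ?S"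
    then obtain x y where "x \<in> ?Q" "y \<in> ?Q" "s = infnorm (x - y)"
      by blast
    then show "s \<in> (\<lambda>(x, y). infnorm (x - y)) ` (?Q \<times> ?Q)"
      by (intro image_eqI[of _ _ "(x, y)"]) simp_all
  qed
  moreover have "of_int K / 2 ^ m \<in> ?S"
  proof -
    have "infnorm (grid_pt m p - grid_pt m p') = of_int K / 2 ^ m"
      by (simp only: infnorm_grid_pt_diff assms(5))
    moreover from this have "grid_pt m p \<noteq> grid_pt m p'"
      using \<open>0 < K\<close> by (auto simp: infnorm_0)
    moreover have "grid_pt m p \<in> ?Q" "grid_pt m p' \<in> ?Q"
      using assms(3,4) by (auto simp: sobol_set_eq_grid_pt[OF assms(1)])
    ultimately show ?thesis
      by (metis (mono_tags, lifting) mem_Collect_eq)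
  qed
  moreover have "of_int K / 2 ^ m \<le> s" if "s \<in> ?S" for s
  proof -
    from that obtain x y where xy: "x \<in> ?Q" "y \<in> ?Q" "x \<noteq> y" "s = infnorm (x - y)"
      by blast
    moreover obtain q where "degree q < m" "x = grid_pt m q"
      using xy(1) by (auto simp: sobol_set_eq_grid_pt[OF assms(1)])
    moreover obtain q' where "degree q' < m" "y = grid_pt m q'"
      using xy(2) by (auto simp: sobol_set_eq_grid_pt[OF assms(1)])
    ultimately obtain q q' where q: "degree q < m" "degree q' < m" "grid_pt m q \<noteq> grid_pt m q'"
        "s = infnorm (grid_pt m q - grid_pt m q')"
      by blast
    have "K \<le> grid_dist m q q'"
      using q by (intro lower) auto
    then show ?thesis
      unfolding q(4) infnorm_grid_pt_diff by (intro divide_right_mono) auto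
  qed
  ultimately have "Min ?S = of_int K / 2 ^ m"
    by (intro Min_eqI)
  then show ?thesis
    by (simp add: sep_radius_def)
qed

subsection \<open>Differences of close points\<close>

lemma quotient_degree:
  assumes "degree F \<le> V + W + c + 1" "A \<le> V + W" "F = xpow A + xpow (V + W) * G"
  shows "degree G \<le> c + 1"
proof (cases "G = 0")
  case False
  have eq: "xpow (V + W) * G = F + xpow A"
    using assms(3) by (simp add: add.commute add.left_commute)
  then have "degree (xpow (V + W) * G) \<le> V + W + c + 1"
    unfolding eq by (intro degree_add_le) (use assms(1,2) in simp_all)
  moreover have "degree (xpow (V + W) * G) = V + W + degree G"
    using False by (simp add: degree_mult_eq)
  ultimately show ?thesis
    by simp
qed simp

lemma xpow_add: "xpow (a + b) = xpow a * xpow b"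
  by (simp add: mult_monom)

lemma xpow_2_power: "xpow (2 ^ v) = xp1 ^ (2 ^ v) + 1"
  by (simp add: xp1_power_2_power add.assoc)

text \<open>Modulo \<open>xp1 ^ V\<close> the factor \<open>xpow V\<close> is 1, which reduces
  \<open>F\<close> to \<open>xpow A + xpow W * G\<close>. The bound \<open>W + c + 1 < V\<close>
  keeps the second summand reduced.\<close>

lemma ex_quotient:
  assumes "V = 2 ^ v" "W + c + 1 < V" 
    and "degree F \<le> V + W + c + 1" "A \<le> V + W"
    and "xpow (V + W) dvd F + xpow A" "xp1 ^ (V + W) dvd F + xp1 ^ B"
  obtains G where "F = xpow A + xpow (V + W) * G" "degree G \<le> c + 1" "degree (xpow W * G) < V"
    "xp1 ^ V dvd xpow A + xpow W * G + xp1 ^ B"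
proof -
  from assms(5) obtain G where "F + xpow A = xpow (V + W) * G"
    by (auto simp: dvd_def)
  then have G: "F = xpow A + xpow (V + W) * G"
    by (metis add.commute bit_poly_add_self_left)
  then have deg: "degree G \<le> c + 1"
    using quotient_degree assms by blast
  have "degree (xpow W * G) \<le> W + degree G"
    using degree_mult_le[of "xpow W" G] by simp
  then have deg2: "degree (xpow W * G) < V"
    using assms(2) deg by linarith
  have "F = xpow A + xpow W * G + xp1 ^ V * (xpow W * G)"
    unfolding G using xpow_2_power[of v]
    by (simp add: assms(1) xpow_add algebra_simps)
  then have eq: "xpow A + xpow W * G + xp1 ^ B = F + xp1 ^ B + xp1 ^ V * (xpow W * G)"
    by (simp add: ac_simps)
  have "xp1 ^ V dvd F + xp1 ^ B"
    using assms(6) by (rule dvd_trans[rotated]) (simp add: le_imp_power_dvd)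
  then have "xp1 ^ V dvd xpow A + xpow W * G + xp1 ^ B"
    unfolding eq by (simp only: dvd_add_left_iff[OF dvd_triv_left])
  with G deg deg2 that show thesis by blast
qed

text \<open>Otherwise the congruence modulo \<open>xp1 ^ V\<close> relates reduced residues and is
  an equation; at 0 its left side vanishes and its right side is 1.\<close>

lemma exponent_ge:
  assumes "V = 2 ^ v" "0 < W" "W + c + 1 < V" 
    and "degree F \<le> V + W + c + 1" "A \<le> V + W" "0 < A"
    and "xpow (V + W) dvd F + xpow A" "xp1 ^ (V + W) dvd F + xp1 ^ B"
  shows "V \<le> A \<or> V \<le> B"
proof (rule ccontr)
  assume "\<not> (V \<le> A \<or> V \<le> B)"
  then have less: "A < V" "B < V" by auto
  obtain G where G: "degree (xpow W * G) < V" "xp1 ^ V dvd xpow A + xpow W * G + xp1 ^ B"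
    using ex_quotient[OF assms(1,3,4,5,7,8)] by metis
  have "xpow A + xpow W * G = xp1 ^ B"
    using G(2) by (rule dvd_degree_less_imp_eq) (use G less in \<open>auto intro: degree_add_less\<close>)
  then have "coeff (xpow A + xpow W * G) 0 = coeff (xp1 ^ B) 0"
    by simp
  then show False
    using assms(2,6) by (simp add: coeff_mult_0 coeff_xp1_power)
qed

text \<open>Since \<open>V \<le> B\<close>, the power of \<open>xp1\<close> drops out modulo
  \<open>xp1 ^ V\<close>, and \<open>xpow A\<close> equals \<open>xpow W * G\<close>. Cancelling
  \<open>xp1 ^ V\<close> leaves a congruence modulo \<open>xp1 ^ W\<close> that restricts
  \<open>d = A - W\<close>.\<close>

lemma close_difference_form:
  assumes "V = 2 ^ v" "W = 2 ^ w" "c < W" "W + c + 1 < V"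
    and "degree F \<le> V + W + c + 1" "F \<noteq> 0" "A \<le> V + W" "B \<le> V + W" "V \<le> B"
    and "xpow (V + W) dvd F + xpow A" "xp1 ^ (V + W) dvd F + xp1 ^ B"
  obtains d where "d = 0 \<or> d = W" "d \<le> c + 1" "F = xpow (W + d) * xp1 ^ V"
proof -
  obtain G where G: "F = xpow A + xpow (V + W) * G" "degree G \<le> c + 1" "degree (xpow W * G) < V"
      "xp1 ^ V dvd xpow A + xpow W * G + xp1 ^ B"
    using ex_quotient[OF assms(1,4,5,7,10,11)] by metis
  have "xp1 ^ V dvd xp1 ^ B"
    using assms(9) by (simp add: le_imp_power_dvd)
  then have dvd: "xp1 ^ V dvd xpow A + xpow W * G"
    using G(4) by (simp add: dvd_add_left_iff)
  have G1: "F = xpow A + xpow V * (xpow W * G)"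
    unfolding G(1) by (simp add: mult_monom flip: mult.assoc)
  \<comment> \<open>If \<open>V \<le> A\<close>, then \<open>xpow A\<close> reduces to
    \<open>xpow (A - V)\<close>, which must equal \<open>xpow W * G\<close>, so the two summands of
    \<open>F\<close> cancel.\<close>
  have "A < V"
  proof (rule ccontr)
    assume "\<not> A < V"
    then have A: "xpow A = xpow V * xpow (A - V)"
      by (simp add: mult_monom)
    then have "xpow A = xpow (A - V) + xp1 ^ V * xpow (A - V)"
      using xpow_2_power[of v] by (simp add: assms(1) algebra_simps)
    then have eq: "xpow A + xpow W * G = xpow (A - V) + xpow W * G + xp1 ^ V * xpow (A - V)"
      by (simp add: ac_simps)
    have "xp1 ^ V dvd xpow (A - V) + xpow W * G"
      using dvd unfolding eq by (simp only: dvd_add_left_iff[OF dvd_triv_left])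
    then have "xpow (A - V) = xpow W * G"
      by (rule dvd_degree_less_imp_eq) (use G(3) assms in auto)
    then have "F = 0"
      unfolding G1 A by simp
    then show False
      using assms(6) by simp
  qed
  have eq: "xpow A = xpow W * G"
    using dvd by (rule dvd_degree_less_imp_eq) (use G(3) \<open>A < V\<close> in auto)
  have F: "F = xpow A * xp1 ^ V"
    unfolding G1 eq[symmetric] using xpow_2_power[of v] by (simp add: assms(1) algebra_simps)
  have "G \<noteq> 0"
    using eq by auto
  then have "A = W + degree G"
    using arg_cong[OF eq, of degree] by (simp add: degree_mult_eq)
  then obtain d where d: "A = W + d" "d \<le> c + 1"
    using G(2) by blast
  have xp1_split: "xp1 ^ B = xp1 ^ V * xp1 ^ (B - V)" "xp1 ^ (V + W) = xp1 ^ V * xp1 ^ W"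
    using assms(9) by (simp_all flip: power_add)
  have "F + xp1 ^ B = xp1 ^ V * (xpow A + xp1 ^ (B - V))"
    unfolding F xp1_split by (simp add: algebra_simps)
  then have "xp1 ^ V * xp1 ^ W dvd xp1 ^ V * (xpow A + xp1 ^ (B - V))"
    using assms(11) unfolding xp1_split by simp
  then have "xp1 ^ W dvd xpow A + xp1 ^ (B - V)"
    by (simp add: dvd_mult_cancel_left)
  \<comment> \<open>\<open>xpow W\<close> is congruent to 1 modulo \<open>xp1 ^ W\<close>, so
    \<open>xpow A\<close> becomes \<open>xpow d\<close>.\<close>
  moreover have "xpow A = xpow d + xp1 ^ W * xpow d"
    unfolding d(1) using xpow_2_power[of w]
    by (simp add: assms(2) xpow_add algebra_simps)
  then have "xpow A + xp1 ^ (B - V) = xpow d + xp1 ^ (B - V) + xp1 ^ W * xpow d"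
    by (simp add: ac_simps)
  ultimately have dvd_d: "xp1 ^ W dvd xpow d + xp1 ^ (B - V)"
    by (simp only: dvd_add_left_iff[OF dvd_triv_left])
  have "d = 0 \<or> d = W"
  proof (rule ccontr)
    assume "\<not> (d = 0 \<or> d = W)"
    then have d': "0 < d" "d < W"
      using d(2) assms(3) by auto
    \<comment> \<open>An equation of residues fails at 0; if \<open>B - V = W\<close>, the power of
      \<open>xp1\<close> vanishes and \<open>xpow d\<close> would be 0.\<close>
    show False
    proof (cases "B - V < W")
      case True
      have "xpow d = xp1 ^ (B - V)"
        using dvd_d by (rule dvd_degree_less_imp_eq) (use True d' in auto)
      then have "coeff (xpow d) 0 = coeff (xp1 ^ (B - V)) 0"
        by simp
      then show False
        using d' by (simp add: coeff_xp1_power)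
    next
      case False
      then have "B - V = W"
        using assms(8) by simp
      then have "xp1 ^ W dvd xpow d + 0"
        using dvd_d by simp
      then have "xpow d = 0"
        by (rule dvd_degree_less_imp_eq) (use d' in auto)
      then show False
        by simp
    qed
  qed
  then show thesis
    using that d(2) F d(1) by blast
qed

text \<open>Stated with coefficients to cover \<open>n = 0\<close>, where no degree is below
  \<open>n\<close>.\<close>

lemma coeff_taylor_shift_eq_0:
  assumes "\<And>i. n \<le> i \<Longrightarrow> coeff p i = 0" "n \<le> i"
  shows "coeff (taylor_shift p) i = 0"
proof (cases "p = 0")
  case False
  then have "degree p < n"
    using assms(1)[of "degree p"] by (meson leading_coeff_0_iff not_le)
  then show ?thesis
    using assms(2) by (intro coeff_eq_0) simp
qed simp

text \<open>Split \<open>u\<close> into \<open>L\<close> below \<open>2 * W\<close> and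
  \<open>xpow (V + W) * R\<close>. Since \<open>xp1 ^ (V + W)\<close> has four terms, the shift of
  \<open>u\<close> is that of \<open>L\<close> plus copies of the shift of \<open>R\<close> at
  offsets 0, \<open>W\<close>, \<open>V\<close> and \<open>V + W\<close>. Each copy has at most
  \<open>W - 1\<close> digits, so \<open>V - 1\<close> and \<open>V + W - 1\<close> fall into
  gaps.\<close>

lemma taylor_shift_gap_coeffs:
  assumes "V = 2 ^ v" "W = 2 ^ w" "2 * W < V"
    and "\<And>i. V + 2 * W - 1 \<le> i \<Longrightarrow> coeff u i = 0"
    and "\<And>i. 2 * W \<le> i \<Longrightarrow> i < V + W \<Longrightarrow> coeff u i = 0"
  shows "coeff (taylor_shift u) (V - 1) = 0" "coeff (taylor_shift u) (V + W - 1) = 0"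
proof -
  define L where "L = poly_cutoff (2 * W) u"
  define R where "R = poly_shift (V + W) u"
  have u: "u = L + xpow (V + W) * R"
    using assms(3,5)
    by (auto simp: poly_eq_iff L_def R_def coeff_poly_cutoff coeff_poly_shift coeff_monom_mult)
  have L: "coeff (taylor_shift L) i = 0" if "2 * W \<le> i" for i
    by (rule coeff_taylor_shift_eq_0[OF _ that]) (simp add: L_def coeff_poly_cutoff)
  have R: "coeff (taylor_shift R) i = 0" if "W - 1 \<le> i" for i
    by (rule coeff_taylor_shift_eq_0[OF _ that]) (use assms(4) in \<open>simp add: R_def coeff_poly_shift\<close>)
  have "xp1 ^ (V + W) = xpow (V + W) + xpow V + xpow W + 1"
    unfolding power_add assms(1,2) xp1_power_2_power by (simp add: algebra_simps mult_monom)
  then have "taylor_shift u = taylor_shift L + xpow (V + W) * taylor_shift R + xpow V * taylor_shift R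
      + xpow W * taylor_shift R + taylor_shift R"
    by (subst u) (simp add: pcompose_add pcompose_mult algebra_simps)
  moreover have "0 < W" by (simp add: assms(2))
  ultimately show "coeff (taylor_shift u) (V - 1) = 0" "coeff (taylor_shift u) (V + W - 1) = 0"
    using assms(3) by (auto simp: coeff_monom_mult L R)
qed

section \<open>Ruling out the remaining candidate differences\<close>

lemma not_close_of_form:
  assumes V: "V = 2 ^ v" and W: "W = 2 ^ w" and c: "c < W" "W + c + 1 < V"
    and m: "m = V + W + c"
    and deg: "degree p < m" "degree p' < m" and ne: "p \<noteq> p'"
    and close: "\<bar>bin_val m (coeff p) - bin_val m (coeff p')\<bar> < 2 ^ (c + 1)"
      "\<bar>bin_val m (coeff (taylor_shift p)) - bin_val m (coeff (taylor_shift p'))\<bar> < 2 ^ (c + 1)"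
    and d: "d = 0 \<or> d = W" "d \<le> c + 1"
    and form: "xpow 1 * xp1 * (p + p') = xpow (W + d) * xp1 ^ V"
  shows False
proof -
  have pos: "0 < V" "0 < W"
    by (simp_all add: V W)
  obtain e where e: "W + d = 2 ^ e"
    using d(1) by (auto simp: W simp flip: power_Suc mult_2)
  have "xpow (W + d) = xpow 1 * xpow (W + d - 1)" "xp1 ^ V = xp1 * xp1 ^ (V - 1)"
    using pos by (simp_all add: mult_monom flip: power_Suc)
  then have "(xpow 1 * xp1) * (p + p') = (xpow 1 * xp1) * (xpow (W + d - 1) * xp1 ^ (V - 1))"
    unfolding form by (simp only: ac_simps)
  then have f: "p + p' = xpow (W + d - 1) * xp1 ^ (V - 1)"
    by simp
  have coeff_f: "coeff p i + coeff p' i = of_bool (W + d - 1 \<le> i \<and> i < W + d - 1 + V)" for i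
    unfolding coeff_add[symmetric] f by (simp only: V coeff_xpow_mult_xp1_power_pred)
  have "taylor_shift p + taylor_shift p' = xpow (V - 1) * xp1 ^ (W + d - 1)"
    unfolding pcompose_add[symmetric] f by (simp only: pcompose_mult taylor_shift_xpow taylor_shift_xp1_power mult.commute)
  then have coeff_g: "coeff (taylor_shift p) i + coeff (taylor_shift p') i
      = of_bool (V - 1 \<le> i \<and> i < V - 1 + (W + d))" for i
    unfolding coeff_add[symmetric] by (simp only: e coeff_xpow_mult_xp1_power_pred)
  from d(1) show False
  proof
    assume "d = 0"
    \<comment> \<open>The block of differing digits ends before \<open>V + W - 1\<close>, which
      leaves \<open>c + 1\<close> common digits at the end.\<close>
    define t where "t = V + W - 1"
    have t: "m = t + (c + 1)"
      using m pos by (simp add: t_def)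
    have suffix: "coeff p i = coeff p' i" if "t \<le> i" for i
    proof -
      have "coeff p i + coeff p' i = 0"
        using that \<open>d = 0\<close> pos unfolding coeff_f by (simp add: t_def) linarith
      then show ?thesis
        by (simp add: bit_add_eq_0_iff)
    qed
    have "bin_val m (coeff p) - bin_val m (coeff p')
        = 2 ^ (c + 1) * (bin_val t (coeff p) - bin_val t (coeff p'))"
      unfolding t by (rule bin_val_diff_eq_suffix) (rule suffix)
    then have "2 ^ (c + 1) * \<bar>bin_val t (coeff p) - bin_val t (coeff p')\<bar> < 2 ^ (c + 1) * 1"
      using close(1) by (simp add: abs_mult)
    then have "\<bar>bin_val t (coeff p) - bin_val t (coeff p')\<bar> < 1"
      by (subst (asm) mult_less_cancel_left_pos) auto
    then have "bin_val t (coeff p) = bin_val t (coeff p')"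
      by simp
    then have "coeff p i = coeff p' i" for i
      using suffix[of i] by (cases "i < t") (auto simp: bin_val_eq_iff)
    then show False
      using ne by (simp add: poly_eq_iff)
  next
    assume "d = W"
    then have cW: "c + 1 = W"
      using d(2) c by simp
    define T where "T = V + W"
    have T: "m = T + c" "T = Suc (V + W - 1)"
      using m pos by (simp_all add: T_def)
    \<comment> \<open>Without the last \<open>c\<close> digits the values differ by at most 2, and
      by an odd number because their final digits differ.\<close>
    have adjacent: "\<bar>bin_val T z - bin_val T z'\<bar> = 1"
      if "\<bar>bin_val m z - bin_val m z'\<bar> < 2 ^ (c + 1)" "z (V + W - 1) + z' (V + W - 1) = 1" for z z'
    proof -
      have "\<bar>bin_val (T + c) z - bin_val (T + c) z'\<bar> < 2 ^ c * 2"
        using that(1) T by (simp add: mult.commute)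
      then have "\<bar>bin_val T z - bin_val T z'\<bar> \<le> 2"
        by (rule bin_val_diff_prefix_le)
      moreover have "odd (bin_val T z - bin_val T z')"
        unfolding T(2) using that(2) by (cases "z (V + W - 1)"; cases "z' (V + W - 1)") auto
      ultimately show ?thesis
        by presburger
    qed
    \<comment> \<open>\<open>u\<close> is the summand that carries the leading one of the carry chain.\<close>
    have no_carry: False
      if succ: "bin_val T (coeff u) = bin_val T (coeff u') + 1"
        and sum: "\<And>i. coeff u i + coeff u' i = of_bool (W + d - 1 \<le> i \<and> i < W + d - 1 + V)"
        and fsum: "\<And>i. coeff (taylor_shift u) i + coeff (taylor_shift u') i = of_bool (V - 1 \<le> i \<and> i < V - 1 + (W + d))"
        and deg: "degree u < m"
        and fclose: "\<bar>bin_val m (coeff (taylor_shift u)) - bin_val m (coeff (taylor_shift u'))\<bar> < 2 ^ (c + 1)"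
      for u u'
    proof -
      obtain a where a: "a < T" "\<And>i. i < a \<Longrightarrow> coeff u' i = coeff u i"
          "\<And>i. i < T \<Longrightarrow> a \<le> i \<Longrightarrow> coeff u' i = of_bool (a < i) \<and> coeff u i = of_bool (i = a)"
        using succ unfolding bin_val_succ_iff by blast
      \<comment> \<open>The carry chain must begin where the difference does, at
        \<open>W + d - 1 = 2 * W - 1\<close>.\<close>
      have "a = 2 * W - 1"
      proof (rule antisym)
        show "a \<le> 2 * W - 1"
          using sum[of "2 * W - 1"] a(2)[of "2 * W - 1"] \<open>d = W\<close> pos by (intro leI notI) auto
        show "2 * W - 1 \<le> a"
          using sum[of a] a(3)[OF a(1)] \<open>d = W\<close> by (intro leI notI) auto
      qed
      \<comment> \<open>After \<open>a\<close> the carry leaves only zeros in \<open>u\<close> up to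
        \<open>V + W\<close>, as the gap lemma requires. Both positions lie in the block of the
        shifted difference, so there the shifted \<open>u'\<close> has ones.\<close>
      have gap: "coeff (taylor_shift u) (V - 1) = 0" "coeff (taylor_shift u) (V + W - 1) = 0"
        by (rule taylor_shift_gap_coeffs[OF V W];
            use deg m cW c a(3) \<open>a = 2 * W - 1\<close> T_def in \<open>auto intro: coeff_eq_0\<close>)+
      have gap': "coeff (taylor_shift u') (V - 1) = 1" "coeff (taylor_shift u') (V + W - 1) = 1"
        using fsum[of "V - 1"] fsum[of "V + W - 1"] gap pos \<open>d = W\<close> by auto
      have "\<bar>bin_val T (coeff (taylor_shift u)) - bin_val T (coeff (taylor_shift u'))\<bar> = 1"
        using fclose by (rule adjacent) (simp only: gap gap' add_0)
      then consider "bin_val T (coeff (taylor_shift u)) = bin_val T (coeff (taylor_shift u')) + 1"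
        | "bin_val T (coeff (taylor_shift u')) = bin_val T (coeff (taylor_shift u)) + 1"
        by linarith
      then show False
      proof cases
        case 1
        then obtain b where b: "b < T" "\<And>i. i < b \<Longrightarrow> coeff (taylor_shift u') i = coeff (taylor_shift u) i"
            "\<And>i. i < T \<Longrightarrow> b \<le> i \<Longrightarrow>
              coeff (taylor_shift u') i = of_bool (b < i) \<and> coeff (taylor_shift u) i = of_bool (i = b)"
          unfolding bin_val_succ_iff by blast
        \<comment> \<open>The chain would begin at \<open>b = V - 1\<close> with a one in the
          shifted \<open>u\<close>, against \<open>gap\<close>.\<close>
        have "b \<le> V - 1"
          using b(2)[of "V - 1"] gap gap' by (intro leI notI) auto
        moreover have "V - 1 \<le> b"
          using b(3)[OF b(1)] fsum[of b] by (intro leI notI) auto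
        ultimately show False
          using b(3)[of b] b(1) gap by auto
      next
        case 2
        then obtain b where b: "b < T" "\<And>i. i < b \<Longrightarrow> coeff (taylor_shift u) i = coeff (taylor_shift u') i"
            "\<And>i. i < T \<Longrightarrow> b \<le> i \<Longrightarrow>
              coeff (taylor_shift u) i = of_bool (b < i) \<and> coeff (taylor_shift u') i = of_bool (i = b)"
          unfolding bin_val_succ_iff by blast
        \<comment> \<open>Now the shifted \<open>u\<close> would have ones after \<open>b\<close>,
          in particular at \<open>V + W - 1\<close>, against \<open>gap\<close>.\<close>
        have "b \<le> V - 1"
          using b(2)[of "V - 1"] gap gap' by (intro leI notI) auto
        then show False
          using b(3)[of "V + W - 1"] gap pos by (auto simp: T_def)
      qed
    qed
    have "coeff p (V + W - 1) + coeff p' (V + W - 1) = 1"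
      unfolding coeff_f using \<open>d = W\<close> pos c cW by simp linarith
    with close(1) have "\<bar>bin_val T (coeff p) - bin_val T (coeff p')\<bar> = 1"
      by (rule adjacent)
    then consider "bin_val T (coeff p) = bin_val T (coeff p') + 1"
      | "bin_val T (coeff p') = bin_val T (coeff p) + 1"
      by linarith
    then show False
    proof cases
      case 1
      then show False
        using coeff_f coeff_g deg(1) close(2) by (rule no_carry)
    next
      case 2
      then show False
        by (rule no_carry)
          (use coeff_f coeff_g deg(2) close(2) in \<open>simp_all add: add.commute abs_minus_commute\<close>)
    qed
  qed
qed

section \<open>Lower bound for the grid distance\<close>

lemma grid_dist_ge:
  assumes V: "V = 2 ^ v" and W: "W = 2 ^ w" and c: "c < W" "W + c + 1 < V"
    and m: "m = V + W + c"
    and deg: "degree p < m" "degree p' < m" and ne: "p \<noteq> p'"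
  shows "2 ^ (c + 1) \<le> grid_dist m p p'"
proof (rule ccontr)
  assume "\<not> 2 ^ (c + 1) \<le> grid_dist m p p'"
  then have close: "\<bar>bin_val m (coeff p) - bin_val m (coeff p')\<bar> < 2 ^ (c + 1)"
      "\<bar>bin_val m (coeff (taylor_shift p)) - bin_val m (coeff (taylor_shift p'))\<bar> < 2 ^ (c + 1)"
    by (auto simp: grid_dist_def)
  have pos: "0 < W"
    by (simp add: W)
  \<comment> \<open>Dropping \<open>c + 1\<close> digits leaves prefixes whose values differ by at
    most one, and the factor \<open>xpow 1\<close> in \<open>F\<close> lifts the modulus from
    \<open>xpow t\<close> to \<open>xpow (V + W)\<close>.\<close>
  define t where "t = V + W - 1"
  have t: "m = t + (c + 1)" "Suc t = V + W"
    using m pos by (simp_all add: t_def)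
  have block: "\<exists>a\<le>t. xpow (V + W) dvd xpow 1 * xp1 * (q + q') + xpow (Suc a)"
    if "\<bar>bin_val m (coeff q) - bin_val m (coeff q')\<bar> < 2 ^ (c + 1)" for q q'
  proof -
    have "\<bar>bin_val (t + (c + 1)) (coeff q) - bin_val (t + (c + 1)) (coeff q')\<bar> < 2 ^ (c + 1) * 1"
      using that unfolding t(1) by simp
    then have "\<bar>bin_val t (coeff q) - bin_val t (coeff q')\<bar> \<le> 1"
      by (rule bin_val_diff_prefix_le)
    then obtain a where a: "a \<le> t" "\<forall>i<t. coeff q i + coeff q' i = of_bool (a \<le> i)"
      using bin_val_adjacent_imp_block by blast
    have "xpow (Suc t) dvd xpow 1 * xp1 * (q + q') + xpow (Suc a)"
      by (rule xpow_dvd_if_block) (use a in auto)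
    then show ?thesis
      using a(1) t(2) by auto
  qed
  define F where "F = xpow 1 * xp1 * (p + p')"
  \<comment> \<open>\<open>xpow 1 * xp1\<close> is invariant under the substitution, so
    \<open>F\<close> treats both coordinates alike.\<close>
  have taylor_shift_F: "taylor_shift F = xpow 1 * xp1 * (taylor_shift p + taylor_shift p')"
    using taylor_shift_xp1 taylor_shift_xpow[of 1] by (simp add: F_def pcompose_mult pcompose_add mult.commute)
  have "p + p' \<noteq> 0"
    using ne by (simp add: bit_poly_add_eq_0_iff)
  then have F0: "F \<noteq> 0"
    by (simp add: F_def)
  have "degree (p + p') < m"
    using deg by (rule degree_add_less)
  moreover have "degree F = 2 + degree (p + p')"
    using \<open>p + p' \<noteq> 0\<close> degree_xp1_power[of 1] by (simp add: F_def degree_mult_eq)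
  ultimately have degF: "degree F \<le> V + W + c + 1"
    using m by simp
  obtain A where A: "0 < A" "A \<le> V + W" "xpow (V + W) dvd F + xpow A"
    using block[OF close(1)] t(2) unfolding F_def by (metis Suc_le_mono zero_less_Suc)
  obtain B where B: "0 < B" "B \<le> V + W" "xpow (V + W) dvd taylor_shift F + xpow B"
    using block[OF close(2)] t(2) unfolding taylor_shift_F by (metis Suc_le_mono zero_less_Suc)
  have flipped: "xp1 ^ (V + W) dvd taylor_shift F + xp1 ^ A" "xp1 ^ (V + W) dvd F + xp1 ^ B"
    using taylor_shift_dvd[OF A(3)] taylor_shift_dvd[OF B(3)] by (simp_all add: pcompose_add)
  have "V \<le> A \<or> V \<le> B"
    by (rule exponent_ge[OF V pos c(2) degF A(2,1,3) flipped(2)])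
  then show False
  proof
    assume "V \<le> B"
    then obtain d where d: "d = 0 \<or> d = W" "d \<le> c + 1" "F = xpow (W + d) * xp1 ^ V"
      using close_difference_form[OF V W c degF F0 A(2) B(2) _ A(3) flipped(2)] by blast
    show False
      by (rule not_close_of_form[OF V W c m deg ne close d(1,2) d(3)[unfolded F_def]])
  next
    \<comment> \<open>This is the previous case for the shifted pair.\<close>
    assume "V \<le> A"
    have "degree (taylor_shift F) \<le> V + W + c + 1" "taylor_shift F \<noteq> 0"
      using degF F0 by simp_all
    then obtain d where d: "d = 0 \<or> d = W" "d \<le> c + 1" "taylor_shift F = xpow (W + d) * xp1 ^ V"
      using close_difference_form[OF V W c _ _ B(2) A(2) \<open>V \<le> A\<close> B(3) flipped(1)] by blast
    have "taylor_shift p \<noteq> taylor_shift p'"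
      using ne by (metis taylor_shift_taylor_shift)
    show False
      by (rule not_close_of_form[OF V W c m _ _ _ _ _ d(1,2) d(3)[unfolded taylor_shift_F]])
        (use deg close \<open>taylor_shift p \<noteq> taylor_shift p'\<close> in simp_all)
  qed
qed

subsection \<open>Close pairs\<close>

lemma grid_dist_eq_power:
  assumes "\<And>i. t \<le> i \<Longrightarrow> coeff p i = coeff p' i"
    and "\<And>i. t \<le> i \<Longrightarrow> coeff (taylor_shift p) i = coeff (taylor_shift p') i"
    and "\<bar>bin_val t (coeff p) - bin_val t (coeff p')\<bar> = 1"
    and "\<bar>bin_val t (coeff (taylor_shift p)) - bin_val t (coeff (taylor_shift p'))\<bar> = 1"
  shows "grid_dist (t + k) p p' = 2 ^ k"
  using bin_val_diff_eq_suffix[of t "coeff p" "coeff p'" k, OF assms(1)]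
    bin_val_diff_eq_suffix[of t "coeff (taylor_shift p)" "coeff (taylor_shift p')" k, OF assms(2)]
  by (simp add: grid_dist_def abs_mult assms(3,4))

text \<open>Both orders are given because the two coordinates of a close pair may carry in opposite
  directions.\<close>

lemma abs_diff_carry:
  assumes "a < t" "\<And>i. i < a \<Longrightarrow> z i = z' i"
    and "\<And>i. a \<le> i \<Longrightarrow> i < t \<Longrightarrow> z i = of_bool (a < i) \<and> z' i = of_bool (i = a)"
  shows "\<bar>bin_val t z - bin_val t z'\<bar> = 1" "\<bar>bin_val t z' - bin_val t z\<bar> = 1"
proof -
  have "bin_val t z' = bin_val t z + 1"
    unfolding bin_val_succ_iff using assms by blast
  then show "\<bar>bin_val t z - bin_val t z'\<bar> = 1" "\<bar>bin_val t z' - bin_val t z\<bar> = 1"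
    by simp_all
qed

lemma xpow_0: "xpow 0 = 1"
  by (simp add: monom_0 one_pCons)

text \<open>The pair is 1 and \<open>p' = x + ... + x ^ (m - 1)\<close>: the first coordinate shows
  a full carry from digit 0, while the shift of \<open>p'\<close> differs from 1 in the last digit
  only.\<close>

lemma ex_close_pow2:
  assumes "1 \<le> v"
  shows "\<exists>p p'. degree p < 2 ^ v \<and> degree p' < 2 ^ v \<and> grid_dist (2 ^ v) p p' = 1"
proof -
  define m :: nat where "m = 2 ^ v"
  have "2 ^ 1 \<le> m"
    unfolding m_def by (rule power_increasing) (use assms in auto)
  then have m: "2 \<le> m"
    by simp
  define p' where "p' = 1 + xpow 0 * xp1 ^ (m - 1)"
  have cp: "coeff p' i = of_bool (0 < i \<and> i < m)" for i
    using m unfolding p'_def coeff_add m_def coeff_xpow_mult_xp1_power_pred by auto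
  have fp: "taylor_shift p' = 1 + xpow (m - 1)"
    by (simp add: p'_def pcompose_add pcompose_mult pcompose_1)
  have "grid_dist (m + 0) 1 p' = 2 ^ 0"
  proof (rule grid_dist_eq_power)
    show "coeff 1 i = coeff p' i" "coeff (taylor_shift 1) i = coeff (taylor_shift p') i" if "m \<le> i" for i
      using that m by (auto simp: cp fp pcompose_1)
    show "\<bar>bin_val m (coeff 1) - bin_val m (coeff p')\<bar> = 1"
      by (rule abs_diff_carry(2)[of 0]) (use m in \<open>auto simp: cp\<close>)
    show "\<bar>bin_val m (coeff (taylor_shift 1)) - bin_val m (coeff (taylor_shift p'))\<bar> = 1"
      by (rule abs_diff_carry(1)[of "m - 1"]) (use m in \<open>auto simp: fp pcompose_1\<close>)
  qed
  moreover have "degree p' < m" "degree (1 :: bit poly) < m"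
    using m by (auto intro!: degree_lessI simp: cp)
  ultimately show ?thesis
    unfolding m_def by (metis add_0_right power_0)
qed

text \<open>Adding \<open>xpow m\<close> cancels the leading term and makes \<open>p'\<close>
  invariant under the substitution, so both coordinates show the same carry against 1.\<close>

lemma ex_close_pow2_pred:
  assumes "1 \<le> v"
  shows "\<exists>p p'. degree p < 2 ^ v - 1 \<and> degree p' < 2 ^ v - 1 \<and> grid_dist (2 ^ v - 1) p p' = 1"
proof -
  define m :: nat where "m = 2 ^ v - 1"
  have "(2 :: nat) ^ 1 \<le> 2 ^ v"
    by (rule power_increasing) (use assms in auto)
  then have m: "1 \<le> m"
    by (simp add: m_def)
  define p' where "p' = 1 + xpow m + xpow 0 * xp1 ^ m"
  have cp: "coeff p' i = of_bool (0 < i \<and> i < m)" for i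
    using m unfolding p'_def coeff_add
    by (subst (2) m_def, unfold coeff_xpow_mult_xp1_power_pred) (auto simp: m_def)
  have fp: "taylor_shift p' = p'"
    by (simp add: p'_def pcompose_add pcompose_mult pcompose_1 xpow_0 ac_simps)
  have "grid_dist (m + 0) 1 p' = 2 ^ 0"
  proof (rule grid_dist_eq_power)
    show "coeff 1 i = coeff p' i" "coeff (taylor_shift 1) i = coeff (taylor_shift p') i" if "m \<le> i" for i
      using that m by (auto simp: cp fp pcompose_1)
    show *: "\<bar>bin_val m (coeff 1) - bin_val m (coeff p')\<bar> = 1"
      by (rule abs_diff_carry(2)[of 0]) (use m in \<open>auto simp: cp\<close>)
    show "\<bar>bin_val m (coeff (taylor_shift 1)) - bin_val m (coeff (taylor_shift p'))\<bar> = 1"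
      using * by (simp only: fp pcompose_1)
  qed
  moreover have "degree p' < m" "degree (1 :: bit poly) < m"
    using m by (auto intro!: degree_lessI simp: cp)
  ultimately show ?thesis
    unfolding m_def by (metis add_0_right power_0)
qed

text \<open>\<open>xpow 1 * xp1 * f\<close> is the candidate \<open>xpow W * xp1 ^ V\<close>; the
  blocks of \<open>f\<close> and of its shift both end before \<open>V + W - 1\<close>.\<close>

lemma ex_close_sum:
  assumes V: "V = 2 ^ v" and W: "W = 2 ^ w" and "W < V"
  shows "\<exists>p p'. degree p < V + W + c \<and> degree p' < V + W + c \<and> grid_dist (V + W + c) p p' = 2 ^ (c + 1)"
proof -
  have pos: "0 < W"
    by (simp add: W)
  \<comment> \<open>On the block of \<open>f\<close>, \<open>p\<close> must read
    \<open>1 0 ... 0\<close>, and on the shifted block its shift must read \<open>0 1 ... 1\<close>.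
    The second term lies outside the first block and turns the shift into
    \<open>xpow V * xp1 ^ (W - 1)\<close>.\<close>
  define p where "p = xpow (W - 1) + xpow (V + W - 1)"
  define f where "f = xpow (W - 1) * xp1 ^ (V - 1)"
  have cp: "coeff p i = of_bool (i = W - 1 \<or> i = V + W - 1)" for i
    using \<open>W < V\<close> pos by (auto simp: p_def)
  have cf: "coeff f i = of_bool (W - 1 \<le> i \<and> i < V + W - 1)" for i
    using pos unfolding f_def V coeff_xpow_mult_xp1_power_pred by (auto simp: V)
  have fp: "coeff (taylor_shift p) i = of_bool (V \<le> i \<and> i < V + W)" for i
  proof -
    have "xp1 ^ (V + W - 1) = xp1 ^ V * xp1 ^ (W - 1)"
      using pos by (simp flip: power_add)
    then have "taylor_shift p = xpow V * xp1 ^ (W - 1)"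
      by (simp add: p_def pcompose_add V xp1_power_2_power algebra_simps)
    then show ?thesis
      by (simp only: W coeff_xpow_mult_xp1_power_pred)
  qed
  have ff: "coeff (taylor_shift f) i = of_bool (V - 1 \<le> i \<and> i < V + W - 1)" for i
  proof -
    have "taylor_shift f = xpow (V - 1) * xp1 ^ (W - 1)"
      by (simp add: f_def pcompose_mult mult.commute)
    then have "coeff (taylor_shift f) i = of_bool (V - 1 \<le> i \<and> i < V - 1 + W)"
      by (simp only: W coeff_xpow_mult_xp1_power_pred)
    then show ?thesis
      using \<open>W < V\<close> by simp
  qed
  define t where "t = V + W - 1"
  have "grid_dist (t + (c + 1)) p (p + f) = 2 ^ (c + 1)"
  proof (rule grid_dist_eq_power)
    show "coeff p i = coeff (p + f) i" "coeff (taylor_shift p) i = coeff (taylor_shift (p + f)) i" if "t \<le> i" for i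
      using that by (simp_all add: t_def cf ff pcompose_add)
    show "\<bar>bin_val t (coeff p) - bin_val t (coeff (p + f))\<bar> = 1"
      by (rule abs_diff_carry(2)[of "W - 1"]) (use \<open>W < V\<close> pos in \<open>auto simp: t_def cp cf\<close>)
    show "\<bar>bin_val t (coeff (taylor_shift p)) - bin_val t (coeff (taylor_shift (p + f)))\<bar> = 1"
      by (rule abs_diff_carry(1)[of "V - 1"]) (use \<open>W < V\<close> pos in \<open>auto simp: t_def fp ff pcompose_add\<close>)
  qed
  moreover have "t + (c + 1) = V + W + c"
    using pos by (simp add: t_def)
  moreover have "degree p < V + W + c" "degree (p + f) < V + W + c"
    using pos by (auto intro!: degree_lessI simp: cp cf)
  ultimately show ?thesis
    by metis
qed

lemma grid_dist_pos:
  assumes "degree p < m" "degree p' < m" "p \<noteq> p'"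
  shows "1 \<le> grid_dist m p p'"
proof (rule ccontr)
  assume "\<not> 1 \<le> grid_dist m p p'"
  then have "bin_val m (coeff p) = bin_val m (coeff p')"
    by (auto simp: grid_dist_def)
  then have "coeff p i = coeff p' i" for i
    using assms(1,2) by (cases "i < m") (auto simp: bin_val_eq_iff coeff_eq_0)
  then show False
    using assms(3) by (simp add: poly_eq_iff)
qed

section \<open>Leading binary digits of \<open>m\<close> and the value of the radius\<close>

lemma ex_pow2_bounds:
  fixes n :: nat
  assumes "0 < n"
  shows "\<exists>k. 2 ^ k \<le> n \<and> n < 2 ^ Suc k"
  using ex_power_ivl1[of 2 n] assms by auto

theorem theorem1p1:
  fixes m N :: nat
  assumes "1 \<le> m" and "N = 2 ^ m"
  shows "((\<exists>v::nat. 1 \<le> v \<and> (m = 2 ^ v \<or> m = 2 ^ v - 1))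
            \<longrightarrow> sep_radius (sobol_set N) = 2 powi (- int m - 1))
       \<and> (\<not> (\<exists>v::nat. 1 \<le> v \<and> (m = 2 ^ v \<or> m = 2 ^ v - 1))
            \<longrightarrow> (\<exists>v w c :: nat. w < v \<and> c < 2 ^ w \<and> m = 2 ^ v + 2 ^ w + c)
              \<and> (\<forall>v w c :: nat. w < v \<and> c < 2 ^ w \<and> m = 2 ^ v + 2 ^ w + c
                    \<longrightarrow> sep_radius (sobol_set N) = 2 powi (- (2 ^ v) - 2 ^ w)))"
proof (intro conjI impI allI)
  assume "\<exists>v. 1 \<le> v \<and> (m = 2 ^ v \<or> m = 2 ^ v - 1)"
  then obtain p p' where "degree p < m" "degree p' < m" "grid_dist m p p' = 1"
    using ex_close_pow2 ex_close_pow2_pred by metis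
  then have "sep_radius (sobol_set N) = of_int 1 / 2 ^ (m + 1)"
    unfolding assms(2) using assms(1) by (intro sep_radius_sobol_set) (auto intro: grid_dist_pos)
  also have "\<dots> = 2 powi (- int (m + 1))"
    by (simp only: power_int_minus power_int_of_nat of_int_1 divide_inverse mult_1)
  also have "- int (m + 1) = - int m - 1"
    by simp
  finally show "sep_radius (sobol_set N) = 2 powi (- int m - 1)" .
next
  assume special: "\<not> (\<exists>v. 1 \<le> v \<and> (m = 2 ^ v \<or> m = 2 ^ v - 1))"
  \<comment> \<open>\<open>1 = 2 ^ 1 - 1\<close> is a special value; this settles
    \<open>m = 2 ^ 0\<close>, which the condition \<open>1 \<le> v\<close> leaves out.\<close>
  then have "m \<noteq> 1"
    by (metis diff_add_inverse2 le_refl one_add_one power_one_right)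
  \<comment> \<open>\<open>v\<close> and then \<open>w\<close> are the positions of the two leading
    ones of \<open>m\<close>.\<close>
  obtain v where v: "2 ^ v \<le> m" "m < 2 ^ Suc v"
    using ex_pow2_bounds[of m] assms(1) by auto
  have "m \<noteq> 2 ^ v"
    using special \<open>m \<noteq> 1\<close> by (cases v) auto
  then have "0 < m - 2 ^ v"
    using v by simp
  then obtain w where w: "2 ^ w \<le> m - 2 ^ v" "m - 2 ^ v < 2 ^ Suc w"
    using ex_pow2_bounds by blast
  have "(2 :: nat) ^ w < 2 ^ v"
    using v w unfolding power_Suc by linarith
  then have "w < v"
    by simp
  moreover have "m = 2 ^ v + 2 ^ w + (m - 2 ^ v - 2 ^ w)" "m - 2 ^ v - 2 ^ w < 2 ^ w"
    using v w by auto
  ultimately show "\<exists>v w c :: nat. w < v \<and> c < 2 ^ w \<and> m = 2 ^ v + 2 ^ w + c"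
    by blast
next
  fix v w c :: nat
  assume special: "\<not> (\<exists>v. 1 \<le> v \<and> (m = 2 ^ v \<or> m = 2 ^ v - 1))"
    and vwc: "w < v \<and> c < 2 ^ w \<and> m = 2 ^ v + 2 ^ w + c"
  define V W :: nat where "V = 2 ^ v" and "W = 2 ^ w"
  have "2 ^ Suc w \<le> V"
    unfolding V_def by (rule power_increasing) (use vwc in auto)
  then have "2 * W \<le> V"
    by (simp add: W_def)
  \<comment> \<open>From \<open>c < W\<close> and \<open>2 * W \<le> V\<close> one gets
    \<open>W + c + 1 \<le> V\<close>, with equality only for
    \<open>m = 2 ^ Suc v - 1\<close>.\<close>
  moreover have "m \<noteq> 2 ^ Suc v - 1"
    using special by (metis le_add1 plus_1_eq_Suc)
  moreover have c: "c < W" and m: "m = V + W + c"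
    using vwc by (auto simp: V_def W_def)
  ultimately have less: "W + c + 1 < V"
    by (auto simp: V_def)
  obtain p p' where "degree p < m" "degree p' < m" "grid_dist m p p' = 2 ^ (c + 1)"
    unfolding m using ex_close_sum[OF V_def W_def, of c] less by auto
  then have "sep_radius (sobol_set N) = of_int (2 ^ (c + 1)) / 2 ^ (m + 1)"
    unfolding assms(2) using assms(1) grid_dist_ge[OF V_def W_def c less m]
    by (intro sep_radius_sobol_set) auto
  also have "\<dots> = 2 powi (- int (V + W))"
    by (simp only: m power_int_minus power_int_of_nat) (simp add: power_add field_simps)
  finally show "sep_radius (sobol_set N) = 2 powi (- (2 ^ v) - 2 ^ w)"
    by (simp add: V_def W_def)
qed

end
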